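(* For all integers $1\leq d,\ell\leq k-1$ and $q\geq 2$, we have $\delta_{qd}^{\mathrm{ham}}(qk,q\ell)\leq \delta_{d}^{\mathrm{ham}}(k,\ell)$.
   Context: A $k$-graph $G$ consists of a vertex set $V(G)$ and an edge set of $k$-element subsets of $V(G)$. For $0\le\ell<k$, a ($k$-uniform) $\ell$-cycle is a $k$-graph whose vertices can be cyclically ordered so that every edge consists of $k$ cyclically consecutive vertices and consecutive edges intersect in exactly $\ell$ vertices. An $\ell$-cycle in $G$ is Hamilton if it covers all vertices of $G$. For $1\le d<k$, $\delta_d(G)$ is the largest $m$ such that every $d$-set of vertices lies in at least $m$ edges. The threshold $\delta_d^{\mathrm{ham}}(k,\ell)$ is the infimum of all $\delta\in[0,1]$ such that for every $\varepsilon>0$ there is $n_0$ such that every $k$-graph $G$ on $n\ge n_0$ vertices with $n$ divisible by $k-\ell$ and $\delta_d(G)\ge(\delta+\varepsilon)\binom{n-d}{k-d}$ contains a Hamilton $\ell$-cycle. *)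

theory Defs
  imports Complex_Main
begin

definition is_kgraph :: "nat \<Rightarrow> nat \<Rightarrow> nat set set \<Rightarrow> bool" where
  "is_kgraph n k E \<longleftrightarrow> (\<forall>e\<in>E. e \<subseteq> {0..<n} \<and> card e = k)"

definition min_deg :: "nat \<Rightarrow> nat \<Rightarrow> nat set set \<Rightarrow> nat" where
  "min_deg n d E = Min {card {e\<in>E. S \<subseteq> e} | S. S \<subseteq> {0..<n} \<and> card S = d}"

definition has_ham_cycle :: "nat \<Rightarrow> nat \<Rightarrow> nat \<Rightarrow> nat set set \<Rightarrow> bool" where
  "has_ham_cycle n k l E \<longleftrightarrow>
     (\<exists>f. bij_betw f {0..<n} {0..<n} \<and>
          (\<forall>i < n div (k - l). (\<lambda>j. f ((i * (k - l) + j) mod n)) ` {0..<k} \<in> E))"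

definition ham_threshold :: "nat \<Rightarrow> nat \<Rightarrow> nat \<Rightarrow> real" where
  "ham_threshold d k l = Inf {\<delta>::real. 0 \<le> \<delta> \<and> \<delta> \<le> 1 \<and>
     (\<forall>\<epsilon>>0. \<exists>n0. \<forall>n\<ge>n0. \<forall>E. is_kgraph n k E \<and> (k - l) dvd n \<and>
        real (min_deg n d E) \<ge> (\<delta> + \<epsilon>) * real ((n - d) choose (k - d))
        \<longrightarrow> has_ham_cycle n k l E)}"

end

theory Submission
  imports Defs "HOL-Combinatorics.Permutations"
begin

text \<open>
  Given a \<open>qk\<close>-graph on \<open>n = q m\<close> vertices, cut a random ordering of the vertices into \<open>m\<close> blocks of
  size \<open>q\<close>, and let \<open>H\<close> be the \<open>k\<close>-graph on the blocks whose edges are the \<open>k\<close>-sets of blocks with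
  union in \<open>G\<close>. A Hamilton \<open>l\<close>-cycle of \<open>H\<close> unfolds to a Hamilton \<open>ql\<close>-cycle of \<open>G\<close>. Conditioned on
  the vertices in a \<open>d\<close>-set of blocks, its expected relative degree in \<open>H\<close> equals the relative degree
  of a \<open>qd\<close>-set in \<open>G\<close>. The degree changes by \<open>O(m ^ (k - d - 1))\<close> under a transposition, so the
  martingale exposing a random permutation entry by entry gives an exponentially small tail, and a
  union bound over the \<open>d\<close>-sets shows that some ordering keeps the minimum degree of \<open>H\<close> large.
\<close>

section \<open>Exponential moments and a lower tail bound for functions of a random
  permutation\<close>

text \<open>For nonnegative \<open>y\<close> this is the standard Taylor bound. For
  \<open>y = - x\<close> it follows from \<open>1 + x + x\<^sup>2 / 2 \<le> exp x\<close>, because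
  multiplying the left side by \<open>1 - x + x\<^sup>2\<close> gives at least 1.\<close>

lemma exp_le_quadratic:
  fixes y :: real
  assumes "\<bar>y\<bar> \<le> 1"
  shows "exp y \<le> 1 + y + y\<^sup>2"
proof (cases "y \<ge> 0")
  case True
  then show ?thesis using assms exp_bound[of y] by simp
next
  case False
  define x where "x = - y"
  have x: "0 \<le> x" using False by (simp add: x_def)
  have "1 \<le> 1 + x\<^sup>2 / 2 + x ^ 3 / 2 + x ^ 4 / 2" using x by simp
  also have "\<dots> = (1 + x + x\<^sup>2 / 2) * (1 - x + x\<^sup>2)"
    by (simp add: field_simps power2_eq_square power3_eq_cube power4_eq_xxxx)
  also have "\<dots> \<le> exp x * (1 - x + x\<^sup>2)"
  proof (rule mult_right_mono)
    show "1 + x + x\<^sup>2 / 2 \<le> exp x" by (rule exp_lower_Taylor_quadratic[OF x])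
    have "0 \<le> (1 - x / 2)\<^sup>2 + 3 / 4 * x\<^sup>2" by simp
    then show "0 \<le> 1 - x + x\<^sup>2" by (simp add: power2_eq_square field_simps)
  qed
  finally have "exp (- x) * 1 \<le> exp (- x) * (exp x * (1 - x + x\<^sup>2))"
    by (intro mult_left_mono) auto
  also have "\<dots> = 1 - x + x\<^sup>2" by (simp add: mult.assoc[symmetric] exp_minus)
  finally show ?thesis by (simp add: x_def)
qed

text \<open>The deviations \<open>u b - \<mu>\<close> sum to zero, so the linear term of the
  quadratic bound on \<open>exp\<close> disappears, and
  \<open>1 + r\<^sup>2 \<le> exp (r\<^sup>2)\<close> absorbs the rest. This is the one-step estimate
  of the martingale argument.\<close>

lemma sum_exp_le_of_abs_deviation_le:
  fixes u :: "'a \<Rightarrow> real" and \<mu> r :: real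
  assumes fin: "finite B" and mean: "sum u B = card B * \<mu>"
    and dev: "\<And>b. b \<in> B \<Longrightarrow> \<bar>u b - \<mu>\<bar> \<le> r" and r: "r \<le> 1"
  shows "(\<Sum>b\<in>B. exp (u b)) \<le> card B * exp (\<mu> + r\<^sup>2)"
proof -
  have "exp (u b - \<mu>) \<le> 1 + (u b - \<mu>) + r\<^sup>2" if "b \<in> B" for b
  proof -
    have "\<bar>u b - \<mu>\<bar> \<le> 1" using dev[OF that] r by linarith
    then have "exp (u b - \<mu>) \<le> 1 + (u b - \<mu>) + (u b - \<mu>)\<^sup>2" by (rule exp_le_quadratic)
    moreover have "(u b - \<mu>)\<^sup>2 \<le> r\<^sup>2" using dev[OF that] by (simp add: abs_le_square_iff[symmetric])
    ultimately show ?thesis by linarith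
  qed
  then have "(\<Sum>b\<in>B. exp (u b - \<mu>)) \<le> (\<Sum>b\<in>B. 1 + (u b - \<mu>) + r\<^sup>2)" by (rule sum_mono)
  also have "\<dots> = card B * (1 + r\<^sup>2)"
    using mean by (simp add: sum.distrib sum_subtractf algebra_simps)
  also have "\<dots> \<le> card B * exp (r\<^sup>2)" by (intro mult_left_mono) auto
  finally have "exp \<mu> * (\<Sum>b\<in>B. exp (u b - \<mu>)) \<le> exp \<mu> * (card B * exp (r\<^sup>2))"
    by (intro mult_left_mono) auto
  then show ?thesis by (simp add: sum_distrib_left exp_add[symmetric]) (simp add: exp_add mult_ac)
qed

text \<open>Peeling off one entry of a permutation multiplies by a transposition on the left,
  whereas the Lipschitz hypotheses below concern transpositions on the right. Conjugating by
  \<open>p\<close> converts one into the other within \<open>A\<close>.\<close>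

lemma transpose_comp_permutes:
  assumes "p permutes A" "a \<in> A" "b \<in> A"
  obtains x y where "x \<in> A" "y \<in> A" "transpose a b \<circ> p = p \<circ> transpose x y"
proof
  show "inv p a \<in> A" "inv p b \<in> A"
    using assms by (auto simp: permutes_in_image[OF permutes_inv])
  show "transpose a b \<circ> p = p \<circ> transpose (inv p a) (inv p b)"
    using transpose_comp_eq[OF permutes_bij[OF assms(1)]] .
qed

text \<open>Induction on \<open>S\<close> exposes the image of one point at a time. The conditional
  means given the image of the new point lie within \<open>2 * c\<close> of their average, so each
  exposure adds \<open>(2 * c)\<^sup>2\<close> to the exponent.\<close>

lemma sum_exp_permutations_le:
  fixes F :: "('a \<Rightarrow> 'a) \<Rightarrow> real" and c :: real
  assumes "finite S" and "c \<ge> 0" and "2 * c \<le> 1"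
    and "\<And>p x y. p permutes S \<Longrightarrow> x \<in> S \<Longrightarrow> y \<in> S \<Longrightarrow> \<bar>F (p \<circ> transpose x y) - F p\<bar> \<le> c"
  shows "(\<Sum>p | p permutes S. exp (F p))
    \<le> fact (card S) * exp ((\<Sum>p | p permutes S. F p) / fact (card S) + card S * (2 * c)\<^sup>2)"
  using assms
proof (induction S arbitrary: F rule: finite_induct)
  case empty
  then show ?case by simp
next
  case (insert a S)
  define N :: real where "N = fact (card S)"
  \<comment> \<open>As \<open>q\<close> will range over permutations of \<open>S\<close>, it fixes
    \<open>a\<close>, and \<open>transpose a b \<circ> q\<close> sends \<open>a\<close> to
    \<open>b\<close>. Thus \<open>G b\<close> is \<open>F\<close> restricted to the permutations
    with image \<open>b\<close> at \<open>a\<close>, and \<open>\<mu> b\<close> is its mean.\<close>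
  define G where "G b q = F (transpose a b \<circ> q)" for b q
  define \<mu> where "\<mu> b = (\<Sum>q | q permutes S. G b q) / N" for b
  define M where "M = (\<Sum>b\<in>insert a S. \<mu> b) / card (insert a S)"
  have N: "N > 0" and cardN: "card {q. q permutes S} = N"
    using insert.hyps by (simp_all add: N_def card_permutations)
  have cS: "card (insert a S) = Suc (card S)" using insert.hyps by simp
  have perm: "q permutes insert a S" if "q permutes S" for q
    using that by (rule permutes_subset) auto
  have permG: "transpose a b \<circ> q permutes insert a S" if "q permutes S" "b \<in> insert a S" for b q
    by (rule permutes_compose[OF perm[OF that(1)]]) (use that in \<open>simp add: permutes_swap_id\<close>)
  have IH: "(\<Sum>q | q permutes S. exp (G b q)) \<le> N * exp (\<mu> b + card S * (2 * c)\<^sup>2)"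
    if b: "b \<in> insert a S" for b
    unfolding N_def \<mu>_def
  proof (rule insert.IH)
    fix p x y assume "p permutes S" "x \<in> S" "y \<in> S"
    then show "\<bar>G b (p \<circ> transpose x y) - G b p\<bar> \<le> c"
      using insert.prems(3)[OF permG[OF _ b], of p x y] unfolding G_def comp_assoc by blast
  qed (use insert.prems in auto)
  have sumF: "(\<Sum>p | p permutes insert a S. f (F p))
      = (\<Sum>b\<in>insert a S. \<Sum>q | q permutes S. f (G b q))" for f :: "real \<Rightarrow> real"
    unfolding G_def by (rule sum_over_permutations_insert) (use insert.hyps in auto)
  \<comment> \<open>The choice \<open>b = a\<close> serves as reference: for the same
    \<open>q\<close>, passing from image \<open>a\<close> to image \<open>b\<close> costs a single
    transposition.\<close>
  have \<mu>a: "\<bar>\<mu> b - \<mu> a\<bar> \<le> c" if b: "b \<in> insert a S" for b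
  proof -
    have "\<bar>G b q - G a q\<bar> \<le> c" if q: "q permutes S" for q
    proof -
      obtain x y where "x \<in> insert a S" "y \<in> insert a S" "transpose a b \<circ> q = q \<circ> transpose x y"
        using transpose_comp_permutes[OF perm[OF q] insertI1 b] by blast
      then show ?thesis using insert.prems(3)[OF perm[OF q], of x y] by (simp add: G_def del: comp_apply)
    qed
    then have "(\<Sum>q | q permutes S. \<bar>G b q - G a q\<bar>) \<le> (\<Sum>q | q permutes S. c)"
      by (intro sum_mono) auto
    then have "\<bar>\<Sum>q | q permutes S. G b q - G a q\<bar> \<le> N * c"
      using cardN by (intro order_trans[OF sum_abs]) simp
    moreover have "\<mu> b - \<mu> a = (\<Sum>q | q permutes S. G b q - G a q) / N"
      by (simp add: \<mu>_def sum_subtractf diff_divide_distrib)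
    ultimately show ?thesis using N by (simp add: abs_divide pos_divide_le_eq mult.commute)
  qed
  \<comment> \<open>Both \<open>\<mu> b\<close> and the average \<open>M\<close> are within
    \<open>c\<close> of \<open>\<mu> a\<close>; this is the source of the factor 2.\<close>
  have "\<bar>\<mu> b - M\<bar> \<le> 2 * c" if b: "b \<in> insert a S" for b
  proof -
    have "(\<Sum>b\<in>insert a S. \<mu> b) \<le> (\<Sum>b\<in>insert a S. \<mu> a + c)"
      by (intro sum_mono) (use \<mu>a in fastforce)
    moreover have "(\<Sum>b\<in>insert a S. \<mu> a - c) \<le> (\<Sum>b\<in>insert a S. \<mu> b)"
      by (intro sum_mono) (use \<mu>a in fastforce)
    ultimately have "M \<le> \<mu> a + c" "\<mu> a - c \<le> M"
      unfolding M_def cS sum_constant by (simp_all add: field_simps)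
    then show ?thesis using \<mu>a[OF b] by linarith
  qed
  moreover have "sum \<mu> (insert a S) = card (insert a S) * M"
    unfolding M_def cS by simp
  ultimately have sum\<mu>: "(\<Sum>b\<in>insert a S. exp (\<mu> b)) \<le> card (insert a S) * exp (M + (2 * c)\<^sup>2)"
    using insert.hyps insert.prems(2) by (intro sum_exp_le_of_abs_deviation_le) auto
  have "(\<Sum>p | p permutes insert a S. exp (F p))
      \<le> (\<Sum>b\<in>insert a S. N * exp (\<mu> b + card S * (2 * c)\<^sup>2))"
    unfolding sumF by (rule sum_mono) (rule IH)
  also have "\<dots> = N * exp (card S * (2 * c)\<^sup>2) * (\<Sum>b\<in>insert a S. exp (\<mu> b))"
    unfolding exp_add sum_distrib_left by (intro sum.cong refl) (simp only: mult_ac)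
  also have "\<dots> \<le> N * exp (card S * (2 * c)\<^sup>2) * (card (insert a S) * exp (M + (2 * c)\<^sup>2))"
    using N by (intro mult_left_mono sum\<mu>) auto
  also have "\<dots> = fact (card (insert a S)) * exp (M + card (insert a S) * (2 * c)\<^sup>2)"
    unfolding cS by (simp add: N_def exp_add algebra_simps)
  also have "M = (\<Sum>p | p permutes insert a S. F p) / fact (card (insert a S))"
    unfolding sumF[of "\<lambda>x. x"] M_def \<mu>_def cS sum_divide_distrib[symmetric] by (simp add: N_def)
  finally show ?case .
qed

text \<open>Chernoff's method: Markov's inequality is applied to \<open>exp (- (t * F p))\<close>,
  whose exponent changes by at most \<open>t * c\<close> under a transposition. The parameter
  \<open>t\<close> stays free, to be balanced against \<open>c\<close> and \<open>\<Delta>\<close>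
  later.\<close>

lemma card_permutations_lower_tail_le:
  fixes F :: "('a \<Rightarrow> 'a) \<Rightarrow> real" and c t \<Delta> :: real
  assumes S: "finite S" and c: "c \<ge> 0" and t: "t \<ge> 0" "2 * (t * c) \<le> 1"
    and lip: "\<And>p x y. p permutes S \<Longrightarrow> x \<in> S \<Longrightarrow> y \<in> S \<Longrightarrow> \<bar>F (p \<circ> transpose x y) - F p\<bar> \<le> c"
    and mean: "(\<Sum>p | p permutes S. F p) \<ge> fact (card S) * \<mu>"
  shows "card {p. p permutes S \<and> F p \<le> \<mu> - \<Delta>}
    \<le> fact (card S) * exp (card S * (2 * (t * c))\<^sup>2 - t * \<Delta>)"
proof -
  let ?N = "fact (card S) :: real"
  let ?bad = "{p. p permutes S \<and> F p \<le> \<mu> - \<Delta>}"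
  have fin: "finite {p. p permutes S}" using S by (rule finite_permutations)
  have "card ?bad * exp (t * \<Delta> - t * \<mu>) = (\<Sum>p\<in>?bad. exp (t * \<Delta> - t * \<mu>))" by simp
  also have "\<dots> \<le> (\<Sum>p\<in>?bad. exp (- (t * F p)))"
  proof (rule sum_mono)
    fix p assume "p \<in> ?bad"
    then have "t * F p \<le> t * (\<mu> - \<Delta>)" using t by (intro mult_left_mono) auto
    then show "exp (t * \<Delta> - t * \<mu>) \<le> exp (- (t * F p))" by (simp add: algebra_simps)
  qed
  also have "\<dots> \<le> (\<Sum>p | p permutes S. exp (- (t * F p)))"
    by (rule sum_mono2[OF fin]) auto
  also have "\<dots> \<le> ?N * exp ((\<Sum>p | p permutes S. - (t * F p)) / ?N + card S * (2 * (t * c))\<^sup>2)"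
  proof (rule sum_exp_permutations_le)
    fix p x y assume "p permutes S" "x \<in> S" "y \<in> S"
    then have "t * \<bar>F (p \<circ> transpose x y) - F p\<bar> \<le> t * c"
      using lip t by (intro mult_left_mono) auto
    moreover have "\<bar>- (t * F (p \<circ> transpose x y)) - - (t * F p)\<bar> = t * \<bar>F (p \<circ> transpose x y) - F p\<bar>"
    proof -
      have "- (t * F (p \<circ> transpose x y)) - - (t * F p) = t * (F p - F (p \<circ> transpose x y))"
        by (simp add: right_diff_distrib)
      then show ?thesis using t by (simp only: abs_mult abs_of_nonneg abs_minus_commute)
    qed
    ultimately show "\<bar>- (t * F (p \<circ> transpose x y)) - - (t * F p)\<bar> \<le> t * c" by simp
  qed (use S t c in auto)
  also have "\<dots> \<le> ?N * exp (- (t * \<mu>) + card S * (2 * (t * c))\<^sup>2)"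
  proof -
    have "t * (?N * \<mu>) \<le> t * (\<Sum>p | p permutes S. F p)" using mean t by (intro mult_left_mono) auto
    then have "(\<Sum>p | p permutes S. - (t * F p)) / ?N \<le> - (t * \<mu>)"
      by (simp add: sum_negf sum_distrib_left[symmetric] field_simps)
    then show ?thesis by simp
  qed
  finally have "card ?bad \<le> ?N * exp (- (t * \<mu>) + card S * (2 * (t * c))\<^sup>2) / exp (t * \<Delta> - t * \<mu>)"
    by (simp add: field_simps)
  also have "\<dots> = ?N * exp (card S * (2 * (t * c))\<^sup>2 - t * \<Delta>)"
    by (simp add: exp_diff[symmetric] flip: times_divide_eq_right)
  finally show ?thesis .
qed

section \<open>Uniform images of sets, and averaging over cosets of a symmetric group\<close>

lemma permutes_image_eqE:
  assumes "finite Q" "W \<subseteq> Q" "W' \<subseteq> Q" "card W = card W'"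
  obtains p where "p permutes Q" "p ` W = W'"
proof -
  have fin: "finite W" "finite W'" using assms finite_subset by auto
  obtain f where f: "bij_betw f W W'"
    using fin assms(4) by (meson finite_same_card_bij)
  have "card (Q - W) = card (Q - W')" using assms fin by (simp add: card_Diff_subset)
  then obtain g where g: "bij_betw g (Q - W) (Q - W')"
    using assms(1) by (meson finite_same_card_bij finite_Diff)
  define p where "p x = (if x \<in> W then f x else if x \<in> Q then g x else x)" for x
  have pW: "bij_betw p W W'" using f by (subst bij_betw_cong[where g = f]) (auto simp: p_def)
  have pQ: "bij_betw p (Q - W) (Q - W')"
    using g by (subst bij_betw_cong[where g = g]) (auto simp: p_def)
  have "bij_betw p (W \<union> (Q - W)) (W' \<union> (Q - W'))"
    by (rule bij_betw_combine[OF pW pQ]) auto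
  then have "bij_betw p Q Q" using assms by (simp add: Un_absorb1)
  then have "p permutes Q" using assms(2) by (intro bij_imp_permutes) (auto simp: p_def)
  then show thesis using that pW by (simp add: bij_betw_imp_surj_on)
qed

text \<open>Left composition with a permutation carrying \<open>W\<close> to \<open>X\<close> shows
  that equally many permutations send \<open>W\<close> to each set of its size. So the image of
  \<open>W\<close> is uniformly distributed, and \<open>\<E>\<close> is hit with probability
  \<open>card \<E>\<close> over the binomial coefficient.\<close>

lemma card_permutations_image_in:
  assumes Q: "finite Q" "W \<subseteq> Q" and \<E>: "\<And>X. X \<in> \<E> \<Longrightarrow> X \<subseteq> Q \<and> card X = card W"
  shows "card {p. p permutes Q \<and> p ` W \<in> \<E>} * (card Q choose card W) = card \<E> * fact (card Q)"
proof -
  define N where "N X = card {p. p permutes Q \<and> p ` W = X}" for X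
  have fin: "finite {p. p permutes Q}" using Q by (simp add: finite_permutations)
  have N: "N X = N W" if X: "X \<subseteq> Q" "card X = card W" for X
  proof -
    obtain r where r: "r permutes Q" "r ` W = X"
      using permutes_image_eqE[of Q W X] Q X by metis
    have "bij_betw ((\<circ>) r) {p. p permutes Q \<and> p ` W = W} {p. p permutes Q \<and> p ` W = X}"
    proof (rule bij_betw_byWitness[where f' = "(\<circ>) (inv r)"])
      have img: "(g \<circ> p) ` W = g ` (p ` W)" for g p :: "'a \<Rightarrow> 'a" by (rule image_comp[symmetric])
      show "(\<circ>) r ` {p. p permutes Q \<and> p ` W = W} \<subseteq> {p. p permutes Q \<and> p ` W = X}"
        using r by (intro image_subsetI CollectI conjI) (auto simp only: mem_Collect_eq img intro: permutes_compose)
      have "inv r ` X = W" using r permutes_inverses(2)[OF r(1)] by (auto simp: image_image)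
      then show "(\<circ>) (inv r) ` {p. p permutes Q \<and> p ` W = X} \<subseteq> {p. p permutes Q \<and> p ` W = W}"
        using r permutes_inv[OF r(1)]
        by (intro image_subsetI CollectI conjI) (auto simp only: mem_Collect_eq img intro: permutes_compose)
    qed (use r in \<open>auto simp: comp_assoc[symmetric] permutes_inv_o\<close>)
    then show ?thesis unfolding N_def by (simp add: bij_betw_same_card)
  qed
  \<comment> \<open>The family \<open>\<X>\<close> is arbitrary because the count is used twice: for
    all subsets of \<open>Q\<close> of size \<open>card W\<close>, which determines
    \<open>N W\<close>, and for \<open>\<E>\<close>.\<close>
  have count: "card {p. p permutes Q \<and> p ` W \<in> \<X>} = card \<X> * N W"
    if \<X>: "\<And>X. X \<in> \<X> \<Longrightarrow> X \<subseteq> Q \<and> card X = card W" for \<X>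
  proof -
    have "finite \<X>" by (rule finite_subset[of _ "Pow Q"]) (use \<X> Q in auto)
    moreover have "{p. p permutes Q \<and> p ` W \<in> \<X>} = (\<Union>X\<in>\<X>. {p. p permutes Q \<and> p ` W = X})" by auto
    ultimately have "card {p. p permutes Q \<and> p ` W \<in> \<X>} = (\<Sum>X\<in>\<X>. N X)"
      unfolding N_def by (simp only:) (rule card_UN_disjoint, auto intro: finite_subset[OF _ fin])
    also have "\<dots> = card \<X> * N W" using N \<X> by simp
    finally show ?thesis .
  qed
  have "p ` W \<in> {X. X \<subseteq> Q \<and> card X = card W}" if "p permutes Q" for p
    using that Q by (auto simp: permutes_in_image card_image permutes_inj_on)
  then have "{p. p permutes Q \<and> p ` W \<in> {X. X \<subseteq> Q \<and> card X = card W}} = {p. p permutes Q}" by blast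
  then have "fact (card Q) = (card Q choose card W) * N W"
    using count[of "{X. X \<subseteq> Q \<and> card X = card W}"] Q by (simp add: card_permutations n_subsets)
  then show ?thesis using count[OF \<E>] by simp
qed

text \<open>Averaging over the cosets \<open>p \<circ> Sym Q\<close> replaces conditioning on the values of \<open>p\<close> outside \<open>Q\<close>.\<close>

lemma card_permutations_le_of_cosets:
  fixes K :: real
  assumes A: "finite A" "Q \<subseteq> A"
    and K: "\<And>p. p permutes A \<Longrightarrow> card {r. r permutes Q \<and> B (p \<circ> r)} \<le> fact (card Q) * K"
  shows "card {p. p permutes A \<and> B p} \<le> fact (card A) * K"
proof -
  let ?A = "{p. p permutes A}" and ?Q = "{r. r permutes Q}"
  have Q: "finite Q" using A finite_subset by auto
  have card_eq: "real (card {p. p permutes C \<and> P p}) = (\<Sum>p | p permutes C. if P p then 1 else 0)"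
    if "finite C" for C and P :: "('a \<Rightarrow> 'a) \<Rightarrow> bool"
    using finite_permutations[OF that] by (simp add: sum.If_cases Int_def)
  have "fact (card Q) * real (card {p. p permutes A \<and> B p})
      = (\<Sum>r\<in>?Q. \<Sum>p\<in>?A. if B p then 1 else 0)"
    by (simp add: card_eq[OF A(1)] card_permutations[OF refl Q])
  also have "\<dots> = (\<Sum>r\<in>?Q. \<Sum>p\<in>?A. if B (p \<circ> r) then 1 else 0)"
    by (rule sum.cong[OF refl], rule sum_permutations_compose_right) (use A permutes_subset in auto)
  also have "\<dots> = (\<Sum>p\<in>?A. \<Sum>r\<in>?Q. if B (p \<circ> r) then 1 else 0)" by (rule sum.swap)
  also have "\<dots> \<le> (\<Sum>p\<in>?A. fact (card Q) * K)"
    by (rule sum_mono) (use K in \<open>simp add: card_eq[OF Q]\<close>)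
  also have "\<dots> = fact (card Q) * (fact (card A) * K)"
    by (simp add: card_permutations[OF refl A(1)])
  finally show ?thesis by simp
qed

section \<open>Blocks, contraction, and unfolding of Hamilton cycles\<close>

definition blocks :: "nat \<Rightarrow> nat set \<Rightarrow> nat set" where
  "blocks q X = {p. p div q \<in> X}"

text \<open>\<open>\<pi>\<close> maps positions to vertices, so the \<open>i\<close>-th block of vertices is \<open>\<pi> ` blocks q {i}\<close>.\<close>

definition contract :: "nat \<Rightarrow> nat \<Rightarrow> nat \<Rightarrow> (nat \<Rightarrow> nat) \<Rightarrow> nat set set \<Rightarrow> nat set set" where
  "contract q m k \<pi> E = {X. X \<subseteq> {0..<m} \<and> card X = k \<and> \<pi> ` blocks q X \<in> E}"

lemma blocks_Un: "blocks q (X \<union> Y) = blocks q X \<union> blocks q Y"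
  by (auto simp: blocks_def)

lemma blocks_mono: "X \<subseteq> Y \<Longrightarrow> blocks q X \<subseteq> blocks q Y"
  by (auto simp: blocks_def)

lemma blocks_Diff: "blocks q (X - Y) = blocks q X - blocks q Y"
  by (auto simp: blocks_def)

lemma blocks_atLeast0LessThan: "q > 0 \<Longrightarrow> blocks q {0..<m} = {0..<q * m}"
  by (auto simp: blocks_def div_less_iff_less_mult mult.commute)

lemma card_blocks:
  assumes "q > 0"
  shows "card (blocks q X) = q * card X"
proof -
  have "bij_betw (\<lambda>(i, j). q * i + j) (X \<times> {0..<q}) (blocks q X)"
    by (rule bij_betw_byWitness[where f' = "\<lambda>p. (p div q, p mod q)"]) (auto simp: blocks_def assms)
  then show ?thesis by (simp add: bij_betw_same_card[symmetric] card_cartesian_product)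
qed

lemma card_supersets:
  assumes V: "finite V" "A \<subseteq> V" and k: "card A \<le> k"
  shows "card {e. A \<subseteq> e \<and> e \<subseteq> V \<and> card e = k} = (card V - card A) choose (k - card A)"
proof -
  have A: "finite A" using V finite_subset by auto
  have "bij_betw (\<lambda>T. A \<union> T) {T. T \<subseteq> V - A \<and> card T = k - card A} {e. A \<subseteq> e \<and> e \<subseteq> V \<and> card e = k}"
  proof (rule bij_betw_byWitness[where f' = "\<lambda>e. e - A"])
    show "(\<union>) A ` {T. T \<subseteq> V - A \<and> card T = k - card A} \<subseteq> {e. A \<subseteq> e \<and> e \<subseteq> V \<and> card e = k}"
    proof (safe, goal_cases)
      case (3 _ T)
      have "finite T" using 3 V finite_subset by (meson finite_Diff)
      then have "card (A \<union> T) = card A + card T" using A 3 by (intro card_Un_disjoint) auto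
      then show ?case using 3 k by simp
    qed (use V in auto)
    show "(\<lambda>e. e - A) ` {e. A \<subseteq> e \<and> e \<subseteq> V \<and> card e = k} \<subseteq> {T. T \<subseteq> V - A \<and> card T = k - card A}"
      using A by (auto simp: card_Diff_subset)
  qed auto
  then show ?thesis using V A by (simp add: bij_betw_same_card[symmetric] n_subsets card_Diff_subset)
qed

text \<open>The unfolded order runs through the blocks in the order \<open>f\<close> and keeps the
  order inside each block. A shift by \<open>q * k - q * l\<close> positions is a shift by
  \<open>k - l\<close> whole blocks, so each window of \<open>q * k\<close> positions starting at a
  multiple of this shift is the union of the blocks of one edge of the contracted cycle.\<close>

lemma has_ham_cycle_of_contract:
  assumes q: "q > 0" and \<pi>: "\<pi> permutes {0..<q * m}"
    and ham: "has_ham_cycle m k l (contract q m k \<pi> E)"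
  shows "has_ham_cycle (q * m) (q * k) (q * l) E"
proof -
  obtain f where f: "bij_betw f {0..<m} {0..<m}"
    and edges: "\<And>i. i < m div (k - l) \<Longrightarrow>
      (\<lambda>j. f ((i * (k - l) + j) mod m)) ` {0..<k} \<in> contract q m k \<pi> E"
    using ham unfolding has_ham_cycle_def by blast
  define h where "h p = q * f (p div q) + p mod q" for p
  have "bij_betw h {0..<q * m} {0..<q * m}"
  proof (rule bij_betw_byWitness[where f' = "\<lambda>p. q * inv_into {0..<m} f (p div q) + p mod q"])
    have div: "p div q < m" if "p < q * m" for p
      using that q by (simp add: div_less_iff_less_mult mult.commute)
    have lt: "q * i + p mod q < q * m" if "i < m" for i p
    proof -
      have "q * i + p mod q < q * Suc i" using q by simp
      also have "\<dots> \<le> q * m" using that by (intro mult_le_mono2) simp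
      finally show ?thesis .
    qed
    have f1: "f i < m" if "i < m" for i using bij_betwE[OF f] that by auto
    have f2: "inv_into {0..<m} f i < m" if "i < m" for i
      using bij_betwE[OF bij_betw_inv_into[OF f]] that by auto
    show "\<forall>p\<in>{0..<q * m}. q * inv_into {0..<m} f (h p div q) + h p mod q = p"
      using q div bij_betw_inv_into_left[OF f] by (auto simp: h_def)
    show "\<forall>p\<in>{0..<q * m}. h (q * inv_into {0..<m} f (p div q) + p mod q) = p"
      using q div bij_betw_inv_into_right[OF f] by (auto simp: h_def)
    show "h ` {0..<q * m} \<subseteq> {0..<q * m}" using lt f1 div by (auto simp: h_def)
    show "(\<lambda>p. q * inv_into {0..<m} f (p div q) + p mod q) ` {0..<q * m} \<subseteq> {0..<q * m}"
      using lt f2 div by auto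
  qed
  then have bij: "bij_betw (\<pi> \<circ> h) {0..<q * m} {0..<q * m}"
    using permutes_imp_bij[OF \<pi>] by (rule bij_betw_trans)
  have qkl: "q * k - q * l = q * (k - l)" by (simp add: diff_mult_distrib2)
  have "(\<lambda>j. (\<pi> \<circ> h) ((i * (q * k - q * l) + j) mod (q * m))) ` {0..<q * k} \<in> E"
    if i: "i < q * m div (q * k - q * l)" for i
  proof -
    define X where "X = (\<lambda>j. f ((i * (k - l) + j) mod m)) ` {0..<k}"
    have "i < m div (k - l)" using i q qkl by simp
    then have "\<pi> ` blocks q X \<in> E" using edges by (simp add: contract_def X_def)
    moreover have "(\<lambda>j. h ((i * (q * k - q * l) + j) mod (q * m))) ` {0..<q * k} = blocks q X"
    proof -
      have h: "h ((i * (q * k - q * l) + j) mod (q * m))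
          = q * f ((i * (k - l) + j div q) mod m) + j mod q" for j
      proof -
        \<comment> \<open>With \<open>j\<close> split into quotient and remainder by
          \<open>q\<close>, reduction modulo \<open>q * m\<close> acts on the block index alone, as
          reduction modulo \<open>m\<close>.\<close>
        have "i * (q * k - q * l) + j = q * (i * (k - l)) + (q * (j div q) + j mod q)"
          unfolding qkl mult_div_mod_eq mult.left_commute[of i q] by (rule refl)
        also have "\<dots> = q * (i * (k - l) + j div q) + j mod q" by (simp only: distrib_left add.assoc)
        also have "\<dots> mod (q * m) = q * ((i * (k - l) + j div q) mod m) + j mod q"
          using q by (simp add: mod_mult2_eq)
        finally show ?thesis using q by (simp add: h_def)
      qed
      show ?thesis unfolding h
      proof (intro equalityI subsetI)
        fix p assume "p \<in> (\<lambda>j. q * f ((i * (k - l) + j div q) mod m) + j mod q) ` {0..<q * k}"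
        then obtain j where j: "j < q * k" "p = q * f ((i * (k - l) + j div q) mod m) + j mod q" by auto
        have "j div q < k" using j q by (simp add: div_less_iff_less_mult mult.commute)
        then show "p \<in> blocks q X" using j q by (auto simp: blocks_def X_def)
      next
        fix p assume "p \<in> blocks q X"
        then obtain j where j: "j < k" "p div q = f ((i * (k - l) + j) mod m)"
          by (auto simp: blocks_def X_def)
        have "q * j + p mod q < q * Suc j" using q by simp
        also have "\<dots> \<le> q * k" using j by (intro mult_le_mono2) simp
        finally have lt: "q * j + p mod q < q * k" .
        have "p = q * (p div q) + p mod q" by simp
        then have "p = q * f ((i * (k - l) + (q * j + p mod q) div q) mod m) + (q * j + p mod q) mod q"
          using j q by simp
        then show "p \<in> (\<lambda>j. q * f ((i * (k - l) + j div q) mod m) + j mod q) ` {0..<q * k}"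
          using lt by (intro image_eqI[of _ _ "q * j + p mod q"]) auto
      qed
    qed
    moreover have "(\<lambda>j. (\<pi> \<circ> h) ((i * (q * k - q * l) + j) mod (q * m))) ` {0..<q * k}
        = \<pi> ` (\<lambda>j. h ((i * (q * k - q * l) + j) mod (q * m))) ` {0..<q * k}"
      by (simp add: image_image)
    ultimately show ?thesis by simp
  qed
  with bij show ?thesis unfolding has_ham_cycle_def by blast
qed

section \<open>Minimum degrees\<close>

lemma min_deg_le:
  assumes "S \<subseteq> {0..<n}" "card S = d"
  shows "min_deg n d E \<le> card {e \<in> E. S \<subseteq> e}"
proof -
  have "finite {card {e \<in> E. S \<subseteq> e} | S. S \<subseteq> {0..<n} \<and> card S = d}"
    by (rule finite_subset[of _ "(\<lambda>S. card {e \<in> E. S \<subseteq> e}) ` Pow {0..<n}"]) auto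
  then show ?thesis unfolding min_deg_def by (rule Min_le) (use assms in auto)
qed

lemma min_deg_attained:
  assumes "d \<le> n"
  obtains S where "S \<subseteq> {0..<n}" "card S = d" "min_deg n d E = card {e \<in> E. S \<subseteq> e}"
proof -
  let ?D = "{card {e \<in> E. S \<subseteq> e} | S. S \<subseteq> {0..<n} \<and> card S = d}"
  have "finite ?D"
    by (rule finite_subset[of _ "(\<lambda>S. card {e \<in> E. S \<subseteq> e}) ` Pow {0..<n}"]) auto
  \<comment> \<open>Nonemptiness makes \<open>Min\<close> the degree of an actual set; this is where
    \<open>d \<le> n\<close> enters.\<close>
  moreover have "card {e \<in> E. {0..<d} \<subseteq> e} \<in> ?D" using assms by fastforce
  ultimately have "Min ?D \<in> ?D" by (intro Min_in) auto
  then show thesis using that by (auto simp: min_deg_def)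
qed

text \<open>The edges through a \<open>d\<close>-set are among the \<open>k\<close>-sets containing
  it. In the comparison of thresholds this excludes relative degrees above 1 and makes 1 an
  admissible value.\<close>

lemma min_deg_le_choose:
  assumes "is_kgraph n k E" "d \<le> k" "d \<le> n"
  shows "min_deg n d E \<le> (n - d) choose (k - d)"
proof -
  have "min_deg n d E \<le> card {e \<in> E. {0..<d} \<subseteq> e}"
    using assms by (intro min_deg_le) auto
  also have "\<dots> \<le> card {e. {0..<d} \<subseteq> e \<and> e \<subseteq> {0..<n} \<and> card e = k}"
    by (rule card_mono) (use assms in \<open>auto simp: is_kgraph_def\<close>)
  also have "\<dots> = (n - d) choose (k - d)" using assms by (subst card_supersets) auto
  finally show ?thesis .
qed

section \<open>Degrees in the contraction along a random ordering\<close>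

lemma abs_diff_card_le:
  assumes "finite D" "A - D = B - D" "finite A" "finite B"
  shows "\<bar>real (card A) - real (card B)\<bar> \<le> card D"
proof -
  have "card A \<le> card (B \<union> D)" "card B \<le> card (A \<union> D)"
    using assms by (auto intro!: card_mono)
  then have "card A \<le> card B + card D" "card B \<le> card A + card D"
    using card_Un_le[of B D] card_Un_le[of A D] by linarith+
  then show ?thesis by linarith
qed

text \<open>Swapping two positions affects only edges containing one of the blocks of
  \<open>x\<close> and \<open>y\<close>. Both blocks lie outside \<open>S\<close>, so an affected
  edge through \<open>S\<close> has only \<open>k - d - 1\<close> further blocks to choose, which
  leaves at most \<open>m ^ (k - d - 1)\<close> edges for each of the two blocks.\<close>

lemma degree_contract_transpose:
  assumes q: "q > 0" and S: "S \<subseteq> {0..<m}" "card S = d" and dk: "d < k" "k \<le> m"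
    and x: "x \<in> {0..<q * m} - blocks q S" and y: "y \<in> {0..<q * m} - blocks q S"
  shows "\<bar>real (card {e \<in> contract q m k (\<pi> \<circ> transpose x y) E. S \<subseteq> e})
      - real (card {e \<in> contract q m k \<pi> E. S \<subseteq> e})\<bar> \<le> 2 * real m ^ (k - d - 1)"
proof -
  define D where "D i = {e. insert i S \<subseteq> e \<and> e \<subseteq> {0..<m} \<and> card e = k}" for i
  have fin: "finite {X. X \<subseteq> {0..<m} \<and> P X}" for P by (rule finite_subset[of _ "Pow {0..<m}"]) auto
  have finS: "finite S" using S finite_subset by auto
  have D: "finite (D i) \<and> card (D i) \<le> m ^ (k - d - 1)" if "i < m" "i \<notin> S" for i
  proof
    have "card (D i) = (m - Suc d) choose (k - Suc d)"
      unfolding D_def using that S finS dk by (subst card_supersets) auto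
    also have "\<dots> \<le> (m - Suc d) ^ (k - Suc d)" using dk by (intro binomial_le_pow) auto
    also have "\<dots> \<le> m ^ (k - Suc d)" by (rule power_mono) auto
    finally show "card (D i) \<le> m ^ (k - d - 1)" by simp
    show "finite (D i)" unfolding D_def by (rule finite_subset[OF _ fin[of "\<lambda>_. True"]]) auto
  qed
  have i: "x div q < m" "y div q < m" "x div q \<notin> S" "y div q \<notin> S"
    using x y q by (auto simp: blocks_def div_less_iff_less_mult mult.commute)
  have same: "transpose x y ` blocks q e = blocks q e" if "x div q \<notin> e" "y div q \<notin> e" for e
    using that by (intro transpose_image_eq) (auto simp: blocks_def)
  have img: "(\<pi> \<circ> transpose x y) ` A = \<pi> ` transpose x y ` A" for A by (rule image_comp[symmetric])
  have "\<bar>real (card {e \<in> contract q m k (\<pi> \<circ> transpose x y) E. S \<subseteq> e})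
      - real (card {e \<in> contract q m k \<pi> E. S \<subseteq> e})\<bar> \<le> card (D (x div q) \<union> D (y div q))"
  proof (rule abs_diff_card_le)
    show "{e \<in> contract q m k (\<pi> \<circ> transpose x y) E. S \<subseteq> e} - (D (x div q) \<union> D (y div q))
        = {e \<in> contract q m k \<pi> E. S \<subseteq> e} - (D (x div q) \<union> D (y div q))"
      unfolding contract_def D_def img using same by auto
  qed (use D i in \<open>auto simp: contract_def intro: finite_subset[OF _ fin[of "\<lambda>_. True"]]\<close>)
  also have "card (D (x div q) \<union> D (y div q)) \<le> 2 * m ^ (k - d - 1)"
    using card_Un_le[of "D (x div q)" "D (y div q)"] D[OF i(1,3)] D[OF i(2,4)] by linarith
  then have "real (card (D (x div q) \<union> D (y div q))) \<le> 2 * real m ^ (k - d - 1)"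
    by (metis of_nat_le_iff of_nat_mult of_nat_numeral of_nat_power)
  finally show ?thesis .
qed

text \<open>Linearity of expectation over the potential edges \<open>e\<close> through
  \<open>S\<close>. A random \<open>r\<close> on \<open>Q\<close> leaves the vertices in the blocks
  of \<open>S\<close> in place and gives the other blocks of \<open>e\<close> a uniformly random set
  of the remaining vertices, so \<open>e\<close> becomes an edge with probability at least
  \<open>a\<close>.\<close>

lemma sum_degree_contract_ge:
  fixes a :: real
  assumes q: "q > 0" and S: "S \<subseteq> {0..<m}" "card S = d" and dk: "d \<le> k" "k \<le> m"
    and E: "is_kgraph (q * m) (q * k) E"
    and deg: "real (min_deg (q * m) (q * d) E) \<ge> a * real ((q * m - q * d) choose (q * k - q * d))"
    and \<pi>: "\<pi> permutes {0..<q * m}" and Q: "Q = {0..<q * m} - blocks q S"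
  shows "(\<Sum>r | r permutes Q. real (card {e \<in> contract q m k (\<pi> \<circ> r) E. S \<subseteq> e}))
    \<ge> fact (card Q) * (a * real ((m - d) choose (k - d)))"
proof -
  define P where "P = blocks q S"
  define C where "C = {e. S \<subseteq> e \<and> e \<subseteq> {0..<m} \<and> card e = k}"
  have PQ: "P \<union> Q = {0..<q * m}" "P \<inter> Q = {}" "finite Q" "P \<subseteq> {0..<q * m}" and finP: "finite P"
    using blocks_mono[OF S(1), of q] blocks_atLeast0LessThan[OF q, of m]
    by (auto simp: Q P_def intro: finite_subset)
  have cP: "card P = q * d" using S q by (simp add: P_def card_blocks)
  have cQ: "card Q = q * m - q * d" unfolding Q P_def[symmetric]
    using PQ finP cP by (simp add: card_Diff_subset)
  have finC: "finite C" by (rule finite_subset[of _ "Pow {0..<m}"]) (auto simp: C_def)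
  have cC: "card C = (m - d) choose (k - d)"
    unfolding C_def using S dk by (subst card_supersets) auto
  \<comment> \<open>The link in \<open>E\<close> of the vertices at the positions \<open>P\<close>,
    pulled back along \<open>\<pi>\<close> to sets of positions in \<open>Q\<close>.\<close>
  define \<E> where "\<E> = {Y. Y \<subseteq> Q \<and> card Y = q * k - q * d \<and> \<pi> ` (P \<union> Y) \<in> E}"
  have "min_deg (q * m) (q * d) E \<le> card {e \<in> E. \<pi> ` P \<subseteq> e}"
  proof (rule min_deg_le)
    show "\<pi> ` P \<subseteq> {0..<q * m}" using PQ permutes_image[OF \<pi>] by blast
    show "card (\<pi> ` P) = q * d" using cP permutes_inj_on[OF \<pi>] by (simp add: card_image)
  qed
  also have "\<dots> \<le> card \<E>"
  proof (rule card_inj_on_le[of "\<lambda>e. inv \<pi> ` e - P"])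
    have inv: "\<pi> ` inv \<pi> ` e = e" "inv \<pi> ` \<pi> ` e = e" for e
      using permutes_inverses[OF \<pi>] by (simp_all add: image_image)
    have back_eq: "P \<union> (inv \<pi> ` e - P) = inv \<pi> ` e" if "\<pi> ` P \<subseteq> e" for e
      using image_mono[OF that, of "inv \<pi>"] inv by auto
    show "inj_on (\<lambda>e. inv \<pi> ` e - P) {e \<in> E. \<pi> ` P \<subseteq> e}"
    proof (rule inj_onI)
      fix e e' assume e: "e \<in> {e \<in> E. \<pi> ` P \<subseteq> e}" "e' \<in> {e \<in> E. \<pi> ` P \<subseteq> e}"
        and eq: "inv \<pi> ` e - P = inv \<pi> ` e' - P"
      have "inv \<pi> ` e = inv \<pi> ` e'" using back_eq[of e] back_eq[of e'] e eq by simp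
      then show "e = e'" using inv by metis
    qed
    show "(\<lambda>e. inv \<pi> ` e - P) ` {e \<in> E. \<pi> ` P \<subseteq> e} \<subseteq> \<E>"
    proof (intro image_subsetI)
      fix e assume "e \<in> {e \<in> E. \<pi> ` P \<subseteq> e}"
      then have e: "e \<in> E" "\<pi> ` P \<subseteq> e" "e \<subseteq> {0..<q * m}" "card e = q * k"
        using E by (auto simp: is_kgraph_def)
      have "inv \<pi> ` e \<subseteq> {0..<q * m}"
        using e image_mono[OF e(3), of "inv \<pi>"] permutes_image[OF permutes_inv[OF \<pi>]] by simp
      then have "inv \<pi> ` e - P \<subseteq> Q" using PQ by blast
      moreover have "card (inv \<pi> ` e - P) = q * k - q * d"
      proof -
        have "P \<subseteq> inv \<pi> ` e" using back_eq[OF e(2)] by blast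
        then show ?thesis using finP cP e permutes_inj_on[OF permutes_inv[OF \<pi>]]
          by (simp add: card_Diff_subset card_image)
      qed
      ultimately show "inv \<pi> ` e - P \<in> \<E>" using e back_eq inv by (simp add: \<E>_def)
    qed
    show "finite \<E>" by (rule finite_subset[of _ "Pow Q"]) (use PQ in \<open>auto simp: \<E>_def\<close>)
  qed
  finally have \<E>: "a * real (card Q choose (q * k - q * d)) \<le> card \<E>" using deg cQ by simp
  have each: "fact (card Q) * a \<le> card {r. r permutes Q \<and> (\<pi> \<circ> r) ` blocks q e \<in> E}"
    if e: "e \<in> C" for e
  proof -
    define W where "W = blocks q (e - S)"
    have finS: "finite S" using S finite_subset by auto
    have "card (e - S) = k - d" using e S finS by (simp add: C_def card_Diff_subset)
    then have cW: "card W = q * k - q * d" using q by (simp add: W_def card_blocks diff_mult_distrib2)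
    have WQ: "W \<subseteq> Q" using e blocks_mono[of e "{0..<m}" q]
      by (auto simp: C_def W_def Q blocks_Diff blocks_atLeast0LessThan[OF q])
    have eW: "blocks q e = P \<union> W" using e unfolding W_def P_def blocks_Un[symmetric]
      by (auto simp: C_def intro!: arg_cong[of _ _ "blocks q"])
    have "(\<pi> \<circ> r) ` blocks q e \<in> E \<longleftrightarrow> r ` W \<in> \<E>" if r: "r permutes Q" for r
    proof -
      have "r ` P = P"
      proof -
        have "r p = p" if "p \<in> P" for p using that PQ(2) permutes_not_in[OF r] by blast
        then show ?thesis by simp
      qed
      then have "(\<pi> \<circ> r) ` blocks q e = \<pi> ` (P \<union> r ` W)"
        unfolding eW image_comp[symmetric] image_Un by simp
      moreover have "r ` W \<subseteq> Q" using WQ permutes_image[OF r] by blast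
      moreover have "card (r ` W) = q * k - q * d"
        using cW permutes_inj_on[OF r] by (simp add: card_image)
      ultimately show ?thesis by (simp add: \<E>_def)
    qed
    then have eq: "{r. r permutes Q \<and> (\<pi> \<circ> r) ` blocks q e \<in> E} = {r. r permutes Q \<and> r ` W \<in> \<E>}"
      by blast
    have "card {r. r permutes Q \<and> r ` W \<in> \<E>} * (card Q choose card W) = card \<E> * fact (card Q)"
      by (rule card_permutations_image_in) (use PQ WQ cW in \<open>auto simp: \<E>_def\<close>)
    then have "real (card {r. r permutes Q \<and> r ` W \<in> \<E>}) * real (card Q choose card W)
        = real (card \<E>) * fact (card Q)"
      by (metis of_nat_mult of_nat_fact)
    moreover have "(a * real (card Q choose card W)) * fact (card Q) \<le> real (card \<E>) * fact (card Q)"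
      using \<E> cW by (intro mult_right_mono) auto
    ultimately have "(fact (card Q) * a) * real (card Q choose card W)
        \<le> real (card {r. r permutes Q \<and> r ` W \<in> \<E>}) * real (card Q choose card W)"
      by (simp add: mult_ac)
    moreover have "0 < real (card Q choose card W)"
      using card_mono[OF PQ(3) WQ] by (simp add: zero_less_binomial_iff)
    ultimately show ?thesis unfolding eq by (rule mult_right_le_imp_le)
  qed
  have finr: "finite {r. r permutes Q}" using PQ by (simp add: finite_permutations)
  have "fact (card Q) * (a * real ((m - d) choose (k - d))) = (\<Sum>e\<in>C. fact (card Q) * a)"
    by (simp add: cC)
  also have "\<dots> \<le> (\<Sum>e\<in>C. real (card {r. r permutes Q \<and> (\<pi> \<circ> r) ` blocks q e \<in> E}))"
    by (rule sum_mono) (rule each)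
  also have "\<dots> = (\<Sum>e\<in>C. \<Sum>r | r permutes Q. if (\<pi> \<circ> r) ` blocks q e \<in> E then 1 else 0)"
    using finr by (simp add: sum.If_cases Int_def)
  also have "\<dots> = (\<Sum>r | r permutes Q. \<Sum>e\<in>C. if (\<pi> \<circ> r) ` blocks q e \<in> E then 1 else 0)"
    by (rule sum.swap)
  also have "\<dots> = (\<Sum>r | r permutes Q. real (card {e \<in> contract q m k (\<pi> \<circ> r) E. S \<subseteq> e}))"
  proof (rule sum.cong[OF refl])
    fix r
    have "{e \<in> contract q m k (\<pi> \<circ> r) E. S \<subseteq> e} = C \<inter> {e. (\<pi> \<circ> r) ` blocks q e \<in> E}"
      by (auto simp: contract_def C_def)
    then show "(\<Sum>e\<in>C. if (\<pi> \<circ> r) ` blocks q e \<in> E then 1 else 0)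
        = real (card {e \<in> contract q m k (\<pi> \<circ> r) E. S \<subseteq> e})"
      using finC by (simp add: sum.If_cases)
  qed
  finally show ?thesis .
qed

text \<open>On each coset of the permutations of \<open>Q\<close>, the vertices in the blocks of
  \<open>S\<close> are fixed, and the mean and Lipschitz bounds feed the tail bound; averaging over
  the cosets removes the conditioning. The Lipschitz constant
  \<open>c = 2 * real m ^ (k - d - 1)\<close> turns \<open>2 * (t * c)\<close> into the expression
  with factor 4.\<close>

lemma card_low_degree_contract_le:
  fixes a \<eta> t :: real
  assumes q: "q > 0" and S: "S \<subseteq> {0..<m}" "card S = d" and dk: "d < k" "k \<le> m"
    and E: "is_kgraph (q * m) (q * k) E"
    and deg: "real (min_deg (q * m) (q * d) E) \<ge> a * real ((q * m - q * d) choose (q * k - q * d))"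
    and t: "t \<ge> 0" "4 * t * real m ^ (k - d - 1) \<le> 1"
  shows "card {\<pi>. \<pi> permutes {0..<q * m} \<and>
      real (card {e \<in> contract q m k \<pi> E. S \<subseteq> e}) \<le> (a - \<eta>) * real ((m - d) choose (k - d))}
    \<le> fact (q * m) * exp (real (q * m) * (4 * t * real m ^ (k - d - 1))\<^sup>2 - t * (\<eta> * real ((m - d) choose (k - d))))"
proof -
  define Q where "Q = {0..<q * m} - blocks q S"
  let ?deg = "\<lambda>\<pi>. real (card {e \<in> contract q m k \<pi> E. S \<subseteq> e})"
  let ?c = "2 * real m ^ (k - d - 1)" and ?C = "real ((m - d) choose (k - d))"
  have Q: "finite Q" "Q \<subseteq> {0..<q * m}" by (auto simp: Q_def)
  have cQ: "card Q \<le> q * m" using card_mono[OF _ Q(2)] by simp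
  have "real (card {r. r permutes Q \<and> ?deg (\<pi> \<circ> r) \<le> (a - \<eta>) * ?C})
      \<le> fact (card Q) * exp (real (q * m) * (4 * t * real m ^ (k - d - 1))\<^sup>2 - t * (\<eta> * ?C))"
    if \<pi>: "\<pi> permutes {0..<q * m}" for \<pi>
  proof -
    have "real (card {r. r permutes Q \<and> ?deg (\<pi> \<circ> r) \<le> a * ?C - \<eta> * ?C})
        \<le> fact (card Q) * exp (card Q * (2 * (t * ?c))\<^sup>2 - t * (\<eta> * ?C))"
    proof (rule card_permutations_lower_tail_le)
      fix r x y assume "r permutes Q" "x \<in> Q" "y \<in> Q"
      then show "\<bar>?deg (\<pi> \<circ> (r \<circ> transpose x y)) - ?deg (\<pi> \<circ> r)\<bar> \<le> ?c"
        using degree_contract_transpose[OF q S dk, of x y "\<pi> \<circ> r" E]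
        by (simp only: Q_def comp_assoc)
    next
      show "fact (card Q) * (a * ?C) \<le> (\<Sum>r | r permutes Q. ?deg (\<pi> \<circ> r))"
        using sum_degree_contract_ge[OF q S _ dk(2) E deg \<pi> Q_def] dk by simp
    qed (use Q t in auto)
    \<comment> \<open>Replacing \<open>card Q\<close> by \<open>q * m\<close> in the exponent only
      weakens the bound.\<close>
    also have "\<dots> \<le> fact (card Q) * exp (real (q * m) * (2 * (t * ?c))\<^sup>2 - t * (\<eta> * ?C))"
    proof -
      have "real (card Q) * (2 * (t * ?c))\<^sup>2 \<le> real (q * m) * (2 * (t * ?c))\<^sup>2"
        using cQ by (intro mult_right_mono) (simp_all only: of_nat_le_iff zero_le_power2)
      then show ?thesis by (intro mult_left_mono) auto
    qed
    finally show ?thesis by (simp add: left_diff_distrib mult_ac)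
  qed
  then have "real (card {\<pi>. \<pi> permutes {0..<q * m} \<and> ?deg \<pi> \<le> (a - \<eta>) * ?C})
    \<le> fact (card {0..<q * m}) * exp (real (q * m) * (4 * t * real m ^ (k - d - 1))\<^sup>2 - t * (\<eta> * ?C))"
    by (intro card_permutations_le_of_cosets[OF _ Q(2)]) auto
  then show ?thesis by simp
qed

section \<open>Asymptotics and the union bound\<close>

lemma eventually_power_mult_exp_less_1:
  fixes \<kappa> :: real
  assumes "\<kappa> > 0"
  shows "eventually (\<lambda>m. real m ^ d * exp (- \<kappa> * real m) < 1) sequentially"
proof -
  have "filterlim (\<lambda>m. \<kappa> * real m) at_top sequentially"
    by (rule filterlim_tendsto_pos_mult_at_top[OF tendsto_const assms filterlim_real_sequentially])
  then have "((\<lambda>m. (\<kappa> * real m) ^ d / exp (\<kappa> * real m)) \<longlongrightarrow> 0) sequentially"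
    by (rule filterlim_compose[OF tendsto_power_div_exp_0])
  then have "eventually (\<lambda>m. (\<kappa> * real m) ^ d / exp (\<kappa> * real m) < \<kappa> ^ d) sequentially"
    by (rule order_tendstoD) (use assms in simp)
  then show ?thesis
  proof eventually_elim
    case (elim m)
    then have "\<kappa> ^ d * (real m ^ d * exp (- \<kappa> * real m)) < \<kappa> ^ d * 1"
      by (simp add: power_mult_distrib exp_minus divide_inverse mult_ac)
    then show ?case using assms by (simp only: mult_less_cancel_left_pos zero_less_power)
  qed
qed

text \<open>From \<open>m \<ge> 2 * k\<close> comes \<open>m - d \<ge> m / 2\<close>. Hence the
  largest possible degree is at least a constant times \<open>m ^ (k - d)\<close>, one factor
  \<open>m\<close> above the order of the change caused by a transposition.\<close>

lemma choose_ge_power: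
  assumes "d < k" "2 * k \<le> m"
  shows "(real m / (2 * real k)) ^ (k - d) \<le> real ((m - d) choose (k - d))"
proof -
  have "real m / (2 * real k) \<le> real (m - d) / real (k - d)"
  proof -
    have "real m * real (k - d) \<le> real m * real k" by (intro mult_left_mono) auto
    also have "\<dots> \<le> (2 * real (m - d)) * real k" using assms by (intro mult_right_mono) auto
    finally show ?thesis using assms by (simp add: field_simps)
  qed
  then have "(real m / (2 * real k)) ^ (k - d) \<le> (real (m - d) / real (k - d)) ^ (k - d)"
    by (intro power_mono) auto
  also have "\<dots> \<le> real ((m - d) choose (k - d))"
    using assms by (intro binomial_ge_n_over_k_pow_k) auto
  finally show ?thesis .
qed

text \<open>Each \<open>d\<close>-set of blocks has too small a degree with probability at most
  \<open>exp (- \<kappa> * m)\<close>, and there are at most \<open>m ^ d\<close> such sets, so for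
  large \<open>m\<close> some ordering is good for all of them. The bound \<open>M\<close> is
  uniform in \<open>E\<close>.\<close>

lemma exists_contract_min_deg_ge:
  fixes a \<eta> :: real
  assumes q: "q > 0" and dk: "d < k" and \<eta>: "\<eta> > 0"
  obtains M where "\<And>m E. m \<ge> M \<Longrightarrow> is_kgraph (q * m) (q * k) E \<Longrightarrow>
      real (min_deg (q * m) (q * d) E) \<ge> a * real ((q * m - q * d) choose (q * k - q * d)) \<Longrightarrow>
      \<exists>\<pi>. \<pi> permutes {0..<q * m} \<and>
        real (min_deg m d (contract q m k \<pi> E)) \<ge> (a - \<eta>) * real ((m - d) choose (k - d))"
proof -
  \<comment> \<open>By \<open>choose_ge_power\<close>, \<open>\<gamma> * m ^ (k - d)\<close> is at
    most the allowed degree loss. In \<open>s\<close>, the value \<open>1 / 4\<close> meets the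
    restriction on \<open>t\<close> in the tail bound, and \<open>\<gamma> / (32 * q)\<close> keeps
    the quadratic term of the exponent below half of \<open>s * \<gamma> * m\<close>, a lower bound
    for the linear term. The other half is \<open>\<kappa> * m\<close>.\<close>
  define \<gamma> where "\<gamma> = \<eta> / (2 * real k) ^ (k - d)"
  define s where "s = min (1 / 4) (\<gamma> / (32 * q))"
  define \<kappa> where "\<kappa> = s * \<gamma> / 2"
  have \<gamma>: "\<gamma> > 0" using \<eta> dk by (simp add: \<gamma>_def)
  have s: "s > 0" "4 * s \<le> 1" "32 * q * s \<le> \<gamma>"
    using \<gamma> q by (auto simp: s_def min_def field_simps)
  obtain M0 where M0: "\<And>m. m \<ge> M0 \<Longrightarrow> real m ^ d * exp (- \<kappa> * real m) < 1"
    using eventually_power_mult_exp_less_1[of \<kappa> d] s \<gamma>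
    by (auto simp: \<kappa>_def eventually_sequentially)
  show thesis
  proof (rule that[of "max M0 (2 * k)"])
    fix m E
    assume m: "max M0 (2 * k) \<le> m" and E: "is_kgraph (q * m) (q * k) E"
      and deg: "a * real ((q * m - q * d) choose (q * k - q * d)) \<le> real (min_deg (q * m) (q * d) E)"
    let ?C = "real ((m - d) choose (k - d))"
    define bad where "bad S = {\<pi>. \<pi> permutes {0..<q * m} \<and>
      real (card {e \<in> contract q m k \<pi> E. S \<subseteq> e}) \<le> (a - \<eta>) * ?C}" for S
    define \<S> where "\<S> = {S. S \<subseteq> {0..<m} \<and> card S = d}"
    \<comment> \<open>This scaling keeps \<open>t\<close> times the Lipschitz constant bounded,
      while \<open>t * (\<eta> * ?C)\<close> still grows at least linearly in
      \<open>m\<close>.\<close>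
    define t where "t = s / real m ^ (k - d - 1)"
    have m0: "real m > 0" using m dk by simp
    have t: "t \<ge> 0" "t * real m ^ (k - d - 1) = s" using s m0 by (simp_all add: t_def)
    have exponent: "real (q * m) * (4 * t * real m ^ (k - d - 1))\<^sup>2 - t * (\<eta> * ?C) \<le> - \<kappa> * m"
    proof -
      have pow: "real m ^ (k - d) = real m ^ (k - d - 1) * real m"
        using dk by (metis Suc_diff_1 power_Suc2 zero_less_diff)
      have "s * \<gamma> * m = t * (\<eta> * (real m / (2 * real k)) ^ (k - d))"
        unfolding power_divide pow \<gamma>_def t(2)[symmetric] by simp
      also have "\<dots> \<le> t * (\<eta> * ?C)"
        using choose_ge_power[OF dk, of m] m \<eta> t by (intro mult_left_mono) auto
      finally have "s * \<gamma> * m \<le> t * (\<eta> * ?C)" .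
      moreover have "real (q * m) * (4 * t * real m ^ (k - d - 1))\<^sup>2 = (m * s / 2) * (32 * q * s)"
        using t(2) by (simp add: mult.assoc power2_eq_square)
      moreover have "(m * s / 2) * (32 * q * s) \<le> (m * s / 2) * \<gamma>"
        using s by (intro mult_left_mono) auto
      ultimately have "real (q * m) * (4 * t * real m ^ (k - d - 1))\<^sup>2 - t * (\<eta> * ?C)
          \<le> (m * s / 2) * \<gamma> - s * \<gamma> * m"
        by linarith
      also have "\<dots> = - \<kappa> * m" by (simp add: \<kappa>_def)
      finally show ?thesis .
    qed
    have bad: "card (bad S) \<le> fact (q * m) * exp (- \<kappa> * m)" if "S \<in> \<S>" for S
    proof -
      have "card (bad S) \<le> fact (q * m) *
          exp (real (q * m) * (4 * t * real m ^ (k - d - 1))\<^sup>2 - t * (\<eta> * ?C))"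
        unfolding bad_def
        by (rule card_low_degree_contract_le[OF q _ _ dk _ E deg])
          (use that m t s in \<open>auto simp: \<S>_def mult.assoc\<close>)
      also have "\<dots> \<le> fact (q * m) * exp (- \<kappa> * m)" using exponent by (intro mult_left_mono) auto
      finally show ?thesis .
    qed
    have fin: "finite \<S>" by (rule finite_subset[of _ "Pow {0..<m}"]) (auto simp: \<S>_def)
    have "card \<S> = m choose d" by (simp add: \<S>_def n_subsets)
    also have "\<dots> \<le> m ^ d" using m dk by (intro binomial_le_pow) auto
    finally have c\<S>: "real (card \<S>) \<le> real m ^ d" by (metis of_nat_le_iff of_nat_power)
    have "real (card (\<Union>S\<in>\<S>. bad S)) \<le> (\<Sum>S\<in>\<S>. real (card (bad S)))"
      using card_UN_le[OF fin, of bad] by (metis of_nat_le_iff of_nat_sum)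
    also have "\<dots> \<le> (\<Sum>S\<in>\<S>. fact (q * m) * exp (- \<kappa> * m))" by (rule sum_mono) (rule bad)
    also have "\<dots> = card \<S> * (fact (q * m) * exp (- \<kappa> * m))" by simp
    also have "\<dots> \<le> real m ^ d * (fact (q * m) * exp (- \<kappa> * m))"
      by (rule mult_right_mono[OF c\<S>]) simp
    also have "\<dots> = fact (q * m) * (real m ^ d * exp (- \<kappa> * m))" by simp
    also have "\<dots> < fact (q * m) * 1"
      using M0[of m] m by (intro mult_strict_left_mono) auto
    also have "\<dots> = card {\<pi>. \<pi> permutes {0..<q * m}}"
      using card_permutations[OF refl, of "{0..<q * m}"] by simp
    finally have "card (\<Union>S\<in>\<S>. bad S) < card {\<pi>. \<pi> permutes {0..<q * m}}" by simp
    then have "\<not> {\<pi>. \<pi> permutes {0..<q * m}} \<subseteq> (\<Union>S\<in>\<S>. bad S)"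
      using card_mono[of "\<Union>S\<in>\<S>. bad S" "{\<pi>. \<pi> permutes {0..<q * m}}"] fin
      by (auto simp: bad_def not_le finite_permutations)
    then obtain \<pi> where \<pi>: "\<pi> permutes {0..<q * m}" "\<And>S. S \<in> \<S> \<Longrightarrow> \<pi> \<notin> bad S" by blast
    obtain S where S: "S \<subseteq> {0..<m}" "card S = d"
        "min_deg m d (contract q m k \<pi> E) = card {e \<in> contract q m k \<pi> E. S \<subseteq> e}"
      using min_deg_attained[of d m] m dk by (metis le_trans less_imp_le max.bounded_iff le_add1 mult_2)
    have "(a - \<eta>) * ?C \<le> real (min_deg m d (contract q m k \<pi> E))"
      using \<pi>(1) \<pi>(2)[of S] S by (simp add: bad_def \<S>_def)
    then show "\<exists>\<pi>. \<pi> permutes {0..<q * m} \<and>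
        (a - \<eta>) * ?C \<le> real (min_deg m d (contract q m k \<pi> E))"
      using \<pi>(1) by blast
  qed
qed

section \<open>Comparison of the thresholds\<close>

theorem theorem1p6:
  fixes d k l q :: nat
  assumes "1 \<le> d" "d \<le> k - 1" "1 \<le> l" "l \<le> k - 1" "q \<ge> 2"
  shows "ham_threshold (q * d) (q * k) (q * l) \<le> ham_threshold d k l"
  unfolding ham_threshold_def
proof (rule cInf_superset_mono)
  have q: "q > 0" and dk: "d < k" and lk: "l < k" using assms by auto
  let ?thr = "\<lambda>d k l. {\<delta>::real. 0 \<le> \<delta> \<and> \<delta> \<le> 1 \<and>
     (\<forall>\<epsilon>>0. \<exists>n0. \<forall>n\<ge>n0. \<forall>E. is_kgraph n k E \<and> (k - l) dvd n \<and>
        real (min_deg n d E) \<ge> (\<delta> + \<epsilon>) * real ((n - d) choose (k - d))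
        \<longrightarrow> has_ham_cycle n k l E)}"
  \<comment> \<open>The value 1 is admissible vacuously: for \<open>n \<ge> k\<close> no
    \<open>k\<close>-graph has relative degree \<open>1 + \<epsilon>\<close>. This gives the
    nonemptiness that comparing the two infima requires.\<close>
  have "has_ham_cycle n k l E"
    if "\<epsilon> > 0" "n \<ge> k" "is_kgraph n k E"
      "real (min_deg n d E) \<ge> (1 + \<epsilon>) * real ((n - d) choose (k - d))" for \<epsilon> :: real and n E
  proof -
    have "min_deg n d E \<le> (n - d) choose (k - d)"
      using that dk by (intro min_deg_le_choose) auto
    then have "(1 + \<epsilon>) * real ((n - d) choose (k - d)) \<le> 1 * real ((n - d) choose (k - d))"
      using that(4) by linarith
    moreover have "real ((n - d) choose (k - d)) > 0" using that dk by simp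
    ultimately have "1 + \<epsilon> \<le> 1" by (rule mult_right_le_imp_le)
    then show ?thesis using that(1) by simp
  qed
  then have "1 \<in> ?thr d k l" by auto
  then show "?thr d k l \<noteq> {}" by blast
  show "bdd_below (?thr (q * d) (q * k) (q * l))" by (rule bdd_belowI[of _ 0]) simp
  \<comment> \<open>Every \<open>\<delta>\<close> admissible for the smaller parameters is shown to
    be admissible for the scaled ones.\<close>
  show "?thr d k l \<subseteq> ?thr (q * d) (q * k) (q * l)"
  proof (intro subsetI CollectI conjI allI impI)
    fix \<delta> \<epsilon> :: real
    assume \<delta>: "\<delta> \<in> ?thr d k l" and \<epsilon>: "\<epsilon> > 0"
    \<comment> \<open>Half of the slack pays for the degree lost in the contraction; the other half
      is what the admissibility of \<open>\<delta>\<close> consumes.\<close>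
    have "\<epsilon> / 2 > 0" using \<epsilon> by simp
    then obtain n0 where n0: "\<And>n E. n \<ge> n0 \<Longrightarrow> is_kgraph n k E \<Longrightarrow> (k - l) dvd n \<Longrightarrow>
        real (min_deg n d E) \<ge> (\<delta> + \<epsilon> / 2) * real ((n - d) choose (k - d)) \<Longrightarrow> has_ham_cycle n k l E"
      using \<delta> by blast
    obtain M where M: "\<And>m E. m \<ge> M \<Longrightarrow> is_kgraph (q * m) (q * k) E \<Longrightarrow>
      real (min_deg (q * m) (q * d) E) \<ge> (\<delta> + \<epsilon>) * real ((q * m - q * d) choose (q * k - q * d)) \<Longrightarrow>
      \<exists>\<pi>. \<pi> permutes {0..<q * m} \<and>
        real (min_deg m d (contract q m k \<pi> E)) \<ge> (\<delta> + \<epsilon> - \<epsilon> / 2) * real ((m - d) choose (k - d))"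
      using exists_contract_min_deg_ge[OF q dk \<open>\<epsilon> / 2 > 0\<close>] by metis
    have "has_ham_cycle n (q * k) (q * l) E"
      if n: "n \<ge> q * max M n0" and E: "is_kgraph n (q * k) E" and dvd: "(q * k - q * l) dvd n"
        and deg: "real (min_deg n (q * d) E) \<ge> (\<delta> + \<epsilon>) * real ((n - q * d) choose (q * k - q * d))"
      for n E
    proof -
      \<comment> \<open>Divisibility by \<open>q * (k - l)\<close> yields both the division of the
        vertices into \<open>m\<close> blocks of size \<open>q\<close> and the divisibility of
        \<open>m\<close> by \<open>k - l\<close>. The bound \<open>q * max M n0\<close> on
        \<open>n\<close> becomes \<open>max M n0\<close> on \<open>m\<close>.\<close>
      have dvd': "q * (k - l) dvd n" using dvd by (simp add: diff_mult_distrib2)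
      then obtain m where m: "n = q * m" by (metis dvd_def mult.assoc)
      have mge: "m \<ge> M" "m \<ge> n0" using n q m by auto
      have klm: "(k - l) dvd m" using dvd' q m by simp
      obtain \<pi> where \<pi>: "\<pi> permutes {0..<q * m}"
          "real (min_deg m d (contract q m k \<pi> E)) \<ge> (\<delta> + \<epsilon> - \<epsilon> / 2) * real ((m - d) choose (k - d))"
        using M[OF mge(1), of E] E deg m by blast
      have "has_ham_cycle m k l (contract q m k \<pi> E)"
      proof (rule n0[OF mge(2) _ klm])
        show "is_kgraph m k (contract q m k \<pi> E)" by (simp add: is_kgraph_def contract_def)
        show "(\<delta> + \<epsilon> / 2) * real ((m - d) choose (k - d)) \<le> real (min_deg m d (contract q m k \<pi> E))"
          using \<pi>(2) by (simp add: add.commute)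
      qed
      then show ?thesis unfolding m by (rule has_ham_cycle_of_contract[OF q \<pi>(1)])
    qed
    then show "\<exists>n0. \<forall>n\<ge>n0. \<forall>E. is_kgraph n (q * k) E \<and> (q * k - q * l) dvd n \<and>
        (\<delta> + \<epsilon>) * real ((n - q * d) choose (q * k - q * d)) \<le> real (min_deg n (q * d) E)
        \<longrightarrow> has_ham_cycle n (q * k) (q * l) E"
      by blast
  qed auto
qed

end
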